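(* Let $K=2$, let $N=n_1+n_2$, and let $\mathbb P_{\boldsymbol b}$ be the uniform probability measure over permutations $\boldsymbol b$ of $\{1,\ldots,N\}$, conditional on $\{Z_1,\ldots,Z_N\}$. Write $\gamma_{1,2}=n_1n_2/(n_1+n_2)^2$, $\widetilde h(Z_i,Z_j)=h(Z_i,Z_i)+h(Z_j,Z_j)-2h(Z_i,Z_j)\ge0$ and $$\widehat\sigma^2=\frac1{N(N-1)}\sum_{\substack{i,j=1\\ i\ne j}}^N\widetilde h(Z_i,Z_j).$$ Then for all $t>0$, $$\mathbb P_{\boldsymbol b}\left(\widehat{\mathcal V}_{h,\max}^{(\boldsymbol b)}\ge t+\sqrt{\frac{\widehat\sigma^2}{2N\gamma_{1,2}}}\right)\le\exp\left(-\frac{N\gamma_{1,2}^2t^2}{2\widehat\sigma^2}\right).$$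
   Context: $h:\mathcal X\times\mathcal X\to\mathbb R$ is the reproducing kernel of a reproducing kernel Hilbert space $\mathcal H$ on $\mathcal X$ with feature map $\psi:\mathcal X\to\mathcal H$, $h(x,y)=\langle\psi(x),\psi(y)\rangle_{\mathcal H}$. The pooled sample $\{Z_1,\ldots,Z_N\}=\{X_{1,1},\ldots,X_{n_1,1},X_{1,2},\ldots,X_{n_2,2}\}$ (in this order, $n_1,n_2\ge1$) consists of points of $\mathcal X$, which are held fixed under $\mathbb P_{\boldsymbol b}$. For a permutation $\boldsymbol b=(b_1,\ldots,b_N)$ of $\{1,\ldots,N\}$ the permuted two-sample statistic is $$\widehat{\mathcal V}_{h,\max}^{(\boldsymbol b)}=\Big\|\frac1{n_1}\sum_{i=1}^{n_1}\psi(Z_{b_i})-\frac1{n_2}\sum_{j=1}^{n_2}\psi(Z_{b_{n_1+j}})\Big\|_{\mathcal H}.$$ When $\widehat\sigma^2=0$, the right-hand side of the inequality is read as $0$. *)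

theory Defs
  imports "HOL-Probability.Probability" "HOL-Combinatorics.Permutations"
begin

text \<open>
  The Hilbert space is a complete inner product type whose elements are realised as
  functions on \<open>'x\<close> through the injection \<open>val\<close>. The first conjunct says that point
  evaluations are continuous linear functionals, the last one is the reproducing property.
\<close>

definition rkhs_kernel ::
  "('h::{real_inner,complete_space} \<Rightarrow> 'x \<Rightarrow> real) \<Rightarrow> ('x \<Rightarrow> 'x \<Rightarrow> real) \<Rightarrow> bool" where
  "rkhs_kernel val h \<longleftrightarrow>
     (\<forall>x. bounded_linear (\<lambda>f. val f x)) \<and> inj val \<and>
     (\<forall>x. \<exists>k. val k = (\<lambda>y. h y x) \<and> (\<forall>f. val f x = f \<bullet> k))"

text \<open>Any feature map of \<open>h\<close> is allowed, not only the canonical \<open>x \<mapsto> h(\<cdot>, x)\<close>.\<close>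

definition feature_map :: "('x \<Rightarrow> 'h::real_inner) \<Rightarrow> ('x \<Rightarrow> 'x \<Rightarrow> real) \<Rightarrow> bool" where
  "feature_map \<psi> h \<longleftrightarrow> (\<forall>x y. h x y = \<psi> x \<bullet> \<psi> y)"

text \<open>
  All samples are indexed from 1; values outside \<open>{1..n1}\<close>, \<open>{1..n2}\<close> and \<open>{1..n1 + n2}\<close>
  play no role.
\<close>

definition pooled :: "nat \<Rightarrow> (nat \<Rightarrow> 'x) \<Rightarrow> (nat \<Rightarrow> 'x) \<Rightarrow> nat \<Rightarrow> 'x" where
  "pooled n1 X1 X2 i = (if i \<le> n1 then X1 i else X2 (i - n1))"

definition perm_stat ::
  "('x \<Rightarrow> 'h::real_inner) \<Rightarrow> nat \<Rightarrow> nat \<Rightarrow> (nat \<Rightarrow> 'x) \<Rightarrow> (nat \<Rightarrow> nat) \<Rightarrow> real" where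
  "perm_stat \<psi> n1 n2 Z b =
     norm ((1 / real n1) *\<^sub>R (\<Sum>i=1..n1. \<psi> (Z (b i))) -
           (1 / real n2) *\<^sub>R (\<Sum>j=1..n2. \<psi> (Z (b (n1 + j)))))"

definition perm_pmf :: "nat \<Rightarrow> (nat \<Rightarrow> nat) pmf" where
  "perm_pmf N = pmf_of_set {b. b permutes {1..N}}"

definition gamma12 :: "nat \<Rightarrow> nat \<Rightarrow> real" where
  "gamma12 n1 n2 = real n1 * real n2 / (real n1 + real n2)^2"

definition htilde :: "('x \<Rightarrow> 'x \<Rightarrow> real) \<Rightarrow> 'x \<Rightarrow> 'x \<Rightarrow> real" where
  "htilde h x y = h x x + h y y - 2 * h x y"

definition sigma2 :: "('x \<Rightarrow> 'x \<Rightarrow> real) \<Rightarrow> nat \<Rightarrow> (nat \<Rightarrow> 'x) \<Rightarrow> real" where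
  "sigma2 h N Z =
     1 / (real N * (real N - 1)) * (\<Sum>i=1..N. \<Sum>j\<in>{1..N} - {i}. htilde h (Z i) (Z j))"

end

theory Submission imports Defs begin

text \<open>
  The statistic is \<open>g(b) = \<parallel>\<Sum>\<^sub>i w\<^sub>i u(b\<^sub>i)\<parallel>\<close>, where \<open>u = \<psi> \<circ> Z\<close> and the weights \<open>w\<^sub>i\<close>
  (\<open>1/n1\<close> on the first group, \<open>-1/n2\<close> on the second) sum to zero. Write \<open>Q\<close> for
  \<open>\<Sum>\<^sub>x\<^sub>,\<^sub>y \<parallel>u x - u y\<parallel>\<^sup>2 = N (N - 1) \<sigma>2\<close> and \<open>\<delta> = 1/n1 + 1/n2 = 1/(N \<gamma>)\<close>.

  The centring term bounds the mean: expanding the square and using exchangeability of a uniform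
  permutation gives exactly \<open>E g\<^sup>2 = \<sigma>2 / (2 N \<gamma>)\<close> (\<open>contrast_second_moment\<close>), and
  \<open>E g \<le> sqrt (E g\<^sup>2)\<close>.

  The deviation from the mean is controlled by a modified logarithmic Sobolev inequality on the
  symmetric group (\<open>modified_log_sobolev_permutations\<close>): for positive \<open>F\<close>,
  \<open>2 N Ent F \<le> E \<Sum>\<^sub>i\<^sub>,\<^sub>j (F - F\<^sub>i\<^sub>j) (ln F - ln F\<^sub>i\<^sub>j)\<close>, where \<open>F\<^sub>i\<^sub>j p = F (p \<circ> (i j))\<close>. It is
  proved by induction on \<open>N\<close>: the chain rule for entropy is applied to the conditioning on
  \<open>p k\<close> and averaged over all positions \<open>k\<close>. The conditional entropies are handled by the
  induction hypothesis. The entropy of the conditional mean, a function of the single value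
  \<open>p k\<close>, is at most a covariance of this function with its logarithm, and joint convexity of
  \<open>(a - b) (ln a - ln b)\<close> turns that covariance back into transpositions \<open>(k j)\<close>.

  Taking \<open>F = exp (s g)\<close>, Herbst's argument yields
  \<open>P (g \<ge> E g + t) \<le> exp (- N t\<^sup>2 / (2 V))\<close> whenever \<open>\<Sum>\<^sub>i\<^sub>,\<^sub>j (g - g\<^sub>i\<^sub>j)\<^sup>2 \<le> V\<close>
  (\<open>permutation_concentration\<close>). Exchanging \<open>i\<close> and \<open>j\<close> moves the vector inside the norm by
  \<open>(w\<^sub>i - w\<^sub>j) (u(b\<^sub>i) - u(b\<^sub>j))\<close>, so \<open>V = \<delta>\<^sup>2 Q = (N - 1) \<sigma>2 / (N \<gamma>\<^sup>2)\<close> is admissible,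
  and \<open>N / (N - 1) \<ge> 1\<close> gives the stated exponent. If \<open>\<sigma>2 = 0\<close>, then \<open>g\<close> vanishes on all
  permutations.
\<close>

section \<open>Entropy on finite sets\<close>

text \<open>
  The transposition of two elements. Its constant is given by its qualified name because the plain
  name \<open>transpose\<close> also denotes the transpose of a matrix.
\<close>

abbreviation swap :: "'a \<Rightarrow> 'a \<Rightarrow> 'a \<Rightarrow> 'a" where
  "swap \<equiv> Transposition.transpose"

lemma sum_swap3: "(\<Sum>x\<in>A. \<Sum>i\<in>B. \<Sum>j\<in>C. h x i j) = (\<Sum>i\<in>B. \<Sum>j\<in>C. \<Sum>x\<in>A. h x i j)"
  by (subst sum.swap, rule sum.cong[OF refl], rule sum.swap)

text \<open>
  The integrand of the Dirichlet form of \<open>F\<close> and \<open>ln F\<close>. It is used for positive arguments only.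
\<close>

definition log_form :: "real \<Rightarrow> real \<Rightarrow> real" where
  "log_form a b = (a - b) * (ln a - ln b)"

lemma log_form_same [simp]: "log_form a a = 0"
  by (simp add: log_form_def)

lemma log_form_commute: "log_form a b = log_form b a"
  by (simp add: log_form_def algebra_simps)

lemma log_form_nonneg:
  assumes "a > 0" "b > 0"
  shows "log_form a b \<ge> 0"
proof (cases "a \<le> b")
  case True
  then have "ln a \<le> ln b" using assms by simp
  with True show ?thesis by (simp add: log_form_def mult_nonpos_nonpos)
next
  case False
  then have "ln b \<le> ln a" using assms by simp
  with False show ?thesis by (simp add: log_form_def)
qed

text \<open>
  The log-sum inequality, that is, joint convexity of \<open>(a, b) \<mapsto> a ln (a / b)\<close> together with its
  homogeneity. Logarithms of quotients are written as differences.
\<close>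

lemma log_sum_inequality:
  fixes a b :: "'i \<Rightarrow> real"
  assumes "finite A" and a: "\<And>i. i \<in> A \<Longrightarrow> a i > 0" and b: "\<And>i. i \<in> A \<Longrightarrow> b i > 0"
  shows "sum a A * (ln (sum a A) - ln (sum b A)) \<le> (\<Sum>i\<in>A. a i * (ln (a i) - ln (b i)))"
proof (cases "A = {}")
  case False
  define s t where "s = sum a A" and "t = sum b A"
  have st: "s > 0" "t > 0"
    using False assms by (auto simp: s_def t_def intro!: sum_pos)
  \<comment> \<open>the tangent inequality \<open>ln y \<le> y - 1\<close> at \<open>y = (b i / a i) (s / t)\<close>, multiplied by \<open>- a i\<close>; the left-hand side below sums to zero\<close>
  have "a i - b i * (s / t) \<le> a i * (ln (a i) - ln (b i)) - a i * (ln s - ln t)" if "i \<in> A" for i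
  proof -
    have pos: "a i > 0" "b i > 0" using that a b by auto
    have "ln ((b i * s) / (a i * t)) \<le> (b i * s) / (a i * t) - 1"
      using pos st by (intro ln_le_minus_one) simp
    also have "ln ((b i * s) / (a i * t)) = ln (b i) + ln s - (ln (a i) + ln t)"
      using pos st by (simp add: ln_div ln_mult)
    finally have "a i * (ln (b i) + ln s - (ln (a i) + ln t)) \<le> a i * ((b i * s) / (a i * t) - 1)"
      using pos by (intro mult_left_mono) auto
    also have "\<dots> = b i * (s / t) - a i"
      using pos st by (simp add: field_simps)
    finally show ?thesis by (simp add: algebra_simps)
  qed
  then have "(\<Sum>i\<in>A. a i - b i * (s / t))
      \<le> (\<Sum>i\<in>A. a i * (ln (a i) - ln (b i)) - a i * (ln s - ln t))"
    by (rule sum_mono)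
  also have "(\<Sum>i\<in>A. a i - b i * (s / t)) = s - t * (s / t)"
    by (simp only: sum_subtractf sum_distrib_right s_def t_def)
  also have "\<dots> = 0" using st by simp
  finally show ?thesis
    unfolding sum_subtractf by (simp add: s_def t_def sum_distrib_right)
qed simp

text \<open>
  Joint subadditivity of \<open>log_form\<close>. As \<open>log_form\<close> is homogeneous of degree one, this is its joint
  convexity.
\<close>

lemma log_form_sum_le:
  fixes a b :: "'i \<Rightarrow> real"
  assumes "finite A" "\<And>i. i \<in> A \<Longrightarrow> a i > 0" "\<And>i. i \<in> A \<Longrightarrow> b i > 0"
  shows "log_form (sum a A) (sum b A) \<le> (\<Sum>i\<in>A. log_form (a i) (b i))"
proof -
  have split: "log_form x y = x * (ln x - ln y) + y * (ln y - ln x)" for x y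
    by (simp add: log_form_def algebra_simps)
  show ?thesis
    unfolding split sum.distrib
    by (intro add_mono log_sum_inequality assms)
qed

text \<open>
  Entropy with respect to the counting measure on a finite set: \<open>card A\<close> times the usual entropy
  \<open>E (f ln f) - E f ln (E f)\<close> under the uniform distribution on \<open>A\<close>.
\<close>

definition entropy :: "('i \<Rightarrow> real) \<Rightarrow> 'i set \<Rightarrow> real" where
  "entropy f A = (\<Sum>i\<in>A. f i * ln (f i)) - sum f A * ln (sum f A / card A)"

text \<open>
  By Jensen's inequality \<open>E (ln f) \<le> ln (E f)\<close>, the entropy is at most the covariance of \<open>f\<close> and
  \<open>ln f\<close>, here expressed through pairs of points.
\<close>

lemma entropy_le_log_form:
  assumes "finite A" "\<And>i. i \<in> A \<Longrightarrow> f i > 0"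
  shows "2 * card A * entropy f A \<le> (\<Sum>i\<in>A. \<Sum>j\<in>A. log_form (f i) (f j))"
proof (cases "A = {}")
  case False
  define n where "n = real (card A)"
  have n: "n > 0" using False assms by (auto simp: n_def card_gt_0_iff)
  define s where "s = sum f A"
  define l where "l = (\<Sum>i\<in>A. ln (f i))"
  define q where "q = (\<Sum>i\<in>A. f i * ln (f i))"
  have s: "s > 0" using False assms by (auto simp: s_def intro!: sum_pos)
  \<comment> \<open>Jensen's inequality for \<open>ln\<close>, from \<open>ln y \<le> y - 1\<close> at \<open>y = f i / (s / n)\<close>\<close>
  have "(\<Sum>i\<in>A. ln (f i) - ln (s / n)) \<le> (\<Sum>i\<in>A. f i * (n / s) - 1)"
  proof (rule sum_mono)
    fix i assume "i \<in> A"
    then have f: "f i > 0" using assms by auto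
    have "ln (f i * (n / s)) \<le> f i * (n / s) - 1"
      using f n s by (intro ln_le_minus_one) simp
    also have "ln (f i * (n / s)) = ln (f i) - ln (s / n)"
      using f n s by (simp add: ln_mult ln_div)
    finally show "ln (f i) - ln (s / n) \<le> f i * (n / s) - 1" .
  qed
  also have "\<dots> = s * (n / s) - n"
    by (simp only: sum_subtractf sum_distrib_right s_def) (simp add: n_def)
  also have "\<dots> = 0" using s by simp
  finally have "l \<le> n * ln (s / n)"
    by (simp add: sum_subtractf l_def n_def)
  then have "s * l \<le> s * (n * ln (s / n))"
    using s by (intro mult_left_mono) auto
  moreover have "(\<Sum>i\<in>A. \<Sum>j\<in>A. log_form (f i) (f j)) = 2 * n * q - 2 * s * l"
  proof -
    have "log_form (f i) (f j) = f i * ln (f i) + f j * ln (f j) - f i * ln (f j) - ln (f i) * f j" for i j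
      by (simp add: log_form_def algebra_simps)
    then have "(\<Sum>i\<in>A. \<Sum>j\<in>A. log_form (f i) (f j)) = n * q + n * q - s * l - l * s"
      by (simp add: sum_subtractf sum.distrib n_def q_def l_def s_def
          flip: sum_distrib_left sum_distrib_right)
    then show ?thesis by (simp add: algebra_simps)
  qed
  moreover have "entropy f A = q - s * ln (s / n)"
    by (simp add: entropy_def q_def s_def n_def)
  moreover have "2 * n * (q - s * ln (s / n)) = 2 * n * q - 2 * (s * (n * ln (s / n)))"
    by (simp add: algebra_simps)
  ultimately show ?thesis
    by (simp flip: n_def)
qed (simp add: entropy_def)

section \<open>A modified logarithmic Sobolev inequality for permutations\<close>

text \<open>
  The permutations of \<open>S\<close> sorted by the image \<open>x\<close> of a fixed element \<open>k\<close>: those with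
  \<open>p k = x\<close> are the \<open>(k x) \<circ> r\<close> with \<open>r\<close> a permutation of \<open>S - {k}\<close>.
\<close>

lemma sum_permutations_by_image:
  fixes g :: "('a \<Rightarrow> 'a) \<Rightarrow> real"
  assumes "finite S" "k \<in> S"
  shows "(\<Sum>p | p permutes S. g p) = (\<Sum>x\<in>S. \<Sum>r | r permutes S - {k}. g (swap k x \<circ> r))"
proof -
  have "insert k (S - {k}) = S" using assms by auto
  moreover have "finite (S - {k})" "k \<notin> S - {k}" using assms by auto
  ultimately show ?thesis using sum_over_permutations_insert[of "S - {k}" k g] by metis
qed

text \<open>
  Chain rule for conditioning on \<open>p k\<close>. The second term is the entropy of the conditional sums, not
  means; the two agree up to a factor because \<open>entropy\<close> is homogeneous of degree one.
\<close>

lemma entropy_permutations_chain_rule: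
  fixes F :: "('a \<Rightarrow> 'a) \<Rightarrow> real"
  assumes S: "finite S" "k \<in> S" and pos: "\<And>p. p permutes S \<Longrightarrow> F p > 0"
  defines "R \<equiv> {r. r permutes S - {k}}"
  shows "entropy F {p. p permutes S} =
    (\<Sum>x\<in>S. entropy (\<lambda>r. F (swap k x \<circ> r)) R) +
    entropy (\<lambda>x. \<Sum>r\<in>R. F (swap k x \<circ> r)) S"
proof -
  define n m where "n = real (card S)" and "m = real (card R)"
  define s where "s x = (\<Sum>r\<in>R. F (swap k x \<circ> r))" for x
  have fR: "finite R" unfolding R_def using S by (intro finite_permutations) auto
  have "id \<in> R" by (simp add: R_def permutes_id)
  then have m: "m > 0" using fR by (auto simp: m_def card_gt_0_iff)
  have n: "n > 0" using S by (auto simp: n_def card_gt_0_iff)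
  have sumP: "(\<Sum>p | p permutes S. g p) = (\<Sum>x\<in>S. \<Sum>r\<in>R. g (swap k x \<circ> r))" for g :: "_ \<Rightarrow> real"
    unfolding R_def by (rule sum_permutations_by_image[OF S])
  have perm: "swap k x \<circ> r permutes S" if "x \<in> S" "r \<in> R" for x r
  proof -
    have "r permutes S" using that(2) by (auto simp: R_def intro: permutes_subset)
    with that S show ?thesis by (auto intro!: permutes_compose permutes_swap_id)
  qed
  have s: "s x > 0" if "x \<in> S" for x
    unfolding s_def using fR \<open>id \<in> R\<close> perm[OF that] pos by (intro sum_pos) auto
  have "sum s S > 0" using S s by (intro sum_pos) auto
  have "card {p. p permutes S} = n * m"
  proof -
    have "real (card {p. p permutes S}) = (\<Sum>p | p permutes S. 1)" by simp
    also have "\<dots> = n * m" by (subst sumP) (simp add: n_def m_def)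
    finally show ?thesis .
  qed
  then have "entropy F {p. p permutes S} =
      (\<Sum>x\<in>S. \<Sum>r\<in>R. F (swap k x \<circ> r) * ln (F (swap k x \<circ> r))) - sum s S * ln (sum s S / (n * m))"
    by (simp add: entropy_def sumP s_def)
  also have "\<dots> = (\<Sum>x\<in>S. (\<Sum>r\<in>R. F (swap k x \<circ> r) * ln (F (swap k x \<circ> r))) - s x * ln (s x / m))
      + ((\<Sum>x\<in>S. s x * ln (s x)) - sum s S * ln (sum s S / n))"
  proof -
    have "(\<Sum>x\<in>S. s x * ln (s x / m)) = (\<Sum>x\<in>S. s x * ln (s x) - s x * ln m)"
      using s m by (intro sum.cong) (auto simp: ln_div algebra_simps)
    also have "\<dots> = (\<Sum>x\<in>S. s x * ln (s x)) - sum s S * ln m"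
      by (simp add: sum_subtractf sum_distrib_right)
    finally show ?thesis
      using \<open>sum s S > 0\<close> m n by (simp add: sum_subtractf ln_div ln_mult algebra_simps)
  qed
  finally show ?thesis
    by (simp add: entropy_def s_def n_def m_def)
qed

text \<open>
  The double sum runs over ordered pairs, so every transposition is counted twice. The constant is
  not optimal: the recursion in the proof would give a slightly better one, but \<open>card S\<close> suffices
  to close the induction.
\<close>

lemma modified_log_sobolev_permutations:
  fixes F :: "('a \<Rightarrow> 'a) \<Rightarrow> real"
  assumes "finite S" "\<And>p. p permutes S \<Longrightarrow> F p > 0"
  shows "2 * card S * entropy F {p. p permutes S} \<le>
    (\<Sum>p | p permutes S. \<Sum>i\<in>S. \<Sum>j\<in>S. log_form (F p) (F (p \<circ> swap i j)))"
  using assms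
proof (induction "card S" arbitrary: S F)
  case 0
  then show ?case by (simp add: sum_nonneg)
next
  case (Suc n)
  note S = \<open>finite S\<close> and pos = Suc.prems(2)
  let ?P = "{p. p permutes S}"
  define E where "E i j = (\<Sum>p\<in>?P. log_form (F p) (F (p \<circ> swap i j)))" for i j
  define D where "D = (\<Sum>i\<in>S. \<Sum>j\<in>S. E i j)"
  have E_same: "E i i = 0" for i by (simp add: E_def)
  have E_nonneg: "E i j \<ge> 0" if "i \<in> S" "j \<in> S" for i j
    unfolding E_def using that pos
    by (intro sum_nonneg log_form_nonneg) (auto intro!: pos permutes_compose permutes_swap_id)
  have D: "D \<ge> 0" unfolding D_def using E_nonneg by (intro sum_nonneg)
  have goal_eq: "(\<Sum>p\<in>?P. \<Sum>i\<in>S. \<Sum>j\<in>S. log_form (F p) (F (p \<circ> swap i j))) = D"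
    unfolding D_def E_def
    by (subst sum.swap, rule sum.cong[OF refl], subst sum.swap, rule refl)
  \<comment> \<open>the chain rule at position \<open>k\<close>: the conditional part and the marginal part\<close>
  have step: "2 * n * entropy F ?P \<le> (\<Sum>i\<in>S - {k}. \<Sum>j\<in>S - {k}. E i j) + real n / Suc n * (\<Sum>j\<in>S. E k j)"
    if k: "k \<in> S" for k
  proof -
    define R where "R = {r. r permutes S - {k}}"
    have fR: "finite R" unfolding R_def using S by (intro finite_permutations) auto
    have sumP: "(\<Sum>p\<in>?P. g p) = (\<Sum>x\<in>S. \<Sum>r\<in>R. g (swap k x \<circ> r))" for g :: "_ \<Rightarrow> real"
      unfolding R_def by (rule sum_permutations_by_image[OF S k])
    have permR: "r permutes S" if "r \<in> R" for r
      using that by (auto simp: R_def intro: permutes_subset)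
    have fixk: "r k = k" if "r \<in> R" for r
      using that by (auto simp: R_def permutes_def)
    have perm: "swap k x \<circ> r permutes S" if "x \<in> S" "r \<in> R" for x r
      using that k permR by (auto intro!: permutes_compose permutes_swap_id)
    define s where "s x = (\<Sum>r\<in>R. F (swap k x \<circ> r))" for x
    have s: "s x > 0" if "x \<in> S" for x
      unfolding s_def using fR perm[OF that] pos
      by (intro sum_pos) (auto simp: R_def intro: permutes_id)
    have "2 * n * (\<Sum>x\<in>S. entropy (\<lambda>r. F (swap k x \<circ> r)) R)
        \<le> (\<Sum>x\<in>S. \<Sum>r\<in>R. \<Sum>i\<in>S - {k}. \<Sum>j\<in>S - {k}.
            log_form (F (swap k x \<circ> r)) (F (swap k x \<circ> r \<circ> swap i j)))"
      unfolding sum_distrib_left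
    proof (rule sum_mono)
      fix x assume x: "x \<in> S"
      have "n = card (S - {k})" using Suc.hyps(2) S k by simp
      from Suc.hyps(1)[OF this, of "\<lambda>r. F (swap k x \<circ> r)"] S perm[OF x] pos
      show "2 * n * entropy (\<lambda>r. F (swap k x \<circ> r)) R
        \<le> (\<Sum>r\<in>R. \<Sum>i\<in>S - {k}. \<Sum>j\<in>S - {k}.
            log_form (F (swap k x \<circ> r)) (F (swap k x \<circ> r \<circ> swap i j)))"
        using \<open>n = card (S - {k})\<close> by (simp add: R_def comp_assoc)
    qed
    also have "\<dots> = (\<Sum>p\<in>?P. \<Sum>i\<in>S - {k}. \<Sum>j\<in>S - {k}. log_form (F p) (F (p \<circ> swap i j)))"
      by (rule sumP[symmetric])
    also have "\<dots> = (\<Sum>i\<in>S - {k}. \<Sum>j\<in>S - {k}. E i j)"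
      unfolding E_def by (subst sum.swap, rule sum.cong[OF refl], subst sum.swap, rule refl)
    finally have cond: "2 * n * (\<Sum>x\<in>S. entropy (\<lambda>r. F (swap k x \<circ> r)) R) \<le> \<dots>" .
    \<comment> \<open>\<open>r \<mapsto> ?q \<circ> r\<close> is the reindexing under which \<open>s y\<close> becomes a sum over the permutations with \<open>p k = x\<close>, composed with \<open>(x y)\<close>\<close>
    have pair: "log_form (s x) (s y)
        \<le> (\<Sum>r\<in>R. log_form (F (swap k x \<circ> r)) (F (swap x y \<circ> (swap k x \<circ> r))))"
      if x: "x \<in> S" and y: "y \<in> S" for x y
    proof -
      let ?q = "swap k y \<circ> swap x y \<circ> swap k x"
      have "?q permutes S" using x y k by (auto intro!: permutes_compose permutes_swap_id)
      moreover have "?q k = k" by (simp add: Transposition.transpose_def)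
      ultimately have q: "?q permutes S - {k}"
        unfolding permutes_def by (metis Diff_iff singletonD)
      have "s y = (\<Sum>r\<in>R. F (swap k y \<circ> (?q \<circ> r)))"
        unfolding s_def R_def by (rule setum_permutations_compose_left[OF q])
      also have "\<dots> = (\<Sum>r\<in>R. F (swap x y \<circ> (swap k x \<circ> r)))"
        by (simp flip: comp_assoc)
      finally have sy: "s y = \<dots>" .
      have "swap x y \<circ> (swap k x \<circ> r) permutes S" if "r \<in> R" for r
        using perm[OF x that] permutes_swap_id[OF x y] by (rule permutes_compose)
      then show ?thesis
        unfolding sy using perm[OF x] pos fR by (subst s_def) (intro log_form_sum_le, auto)
    qed
    have "2 * Suc n * entropy s S \<le> (\<Sum>x\<in>S. \<Sum>y\<in>S. log_form (s x) (s y))"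
      using entropy_le_log_form[of S s] S s Suc.hyps(2) by simp
    also have "\<dots> \<le> (\<Sum>x\<in>S. \<Sum>y\<in>S. \<Sum>r\<in>R.
        log_form (F (swap k x \<circ> r)) (F (swap x y \<circ> (swap k x \<circ> r))))"
      by (intro sum_mono pair)
    also have "\<dots> = (\<Sum>x\<in>S. \<Sum>r\<in>R. \<Sum>y\<in>S.
        log_form (F (swap k x \<circ> r)) (F (swap ((swap k x \<circ> r) k) y \<circ> (swap k x \<circ> r))))"
      by (intro sum.cong refl, subst sum.swap) (simp add: fixk)
    also have "\<dots> = (\<Sum>p\<in>?P. \<Sum>y\<in>S. log_form (F p) (F (swap (p k) y \<circ> p)))"
      by (rule sumP[symmetric])
    \<comment> \<open>with \<open>y = p j\<close>, exchanging the values \<open>p k\<close> and \<open>y\<close> is exchanging the positions \<open>k\<close> and \<open>j\<close>\<close>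
    also have "\<dots> = (\<Sum>p\<in>?P. \<Sum>j\<in>S. log_form (F p) (F (p \<circ> swap k j)))"
    proof (rule sum.cong[OF refl])
      fix p assume "p \<in> ?P"
      then have p: "p permutes S" by simp
      have eq: "swap (p k) (p j) \<circ> p = p \<circ> swap k j" for j
        using transpose_comp_eq[OF permutes_bij[OF p]] permutes_inverses[OF p] by simp
      have "(\<Sum>y\<in>S. log_form (F p) (F (swap (p k) y \<circ> p))) =
          (\<Sum>j\<in>S. log_form (F p) (F (swap (p k) (p j) \<circ> p)))"
        using sum.permute[OF p] by (simp add: comp_def)
      then show "(\<Sum>y\<in>S. log_form (F p) (F (swap (p k) y \<circ> p))) =
          (\<Sum>j\<in>S. log_form (F p) (F (p \<circ> swap k j)))"
        by (simp only: eq)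
    qed
    also have "\<dots> = (\<Sum>j\<in>S. E k j)"
      unfolding E_def by (rule sum.swap)
    finally have marg: "2 * Suc n * entropy s S \<le> (\<Sum>j\<in>S. E k j)" .
    have "2 * n * entropy s S = real n / Suc n * (2 * Suc n * entropy s S)"
      by (simp add: field_simps)
    also have "\<dots> \<le> real n / Suc n * (\<Sum>j\<in>S. E k j)"
      by (intro mult_left_mono marg) simp
    finally have marg': "2 * n * entropy s S \<le> real n / Suc n * (\<Sum>j\<in>S. E k j)" .
    have "entropy F ?P = (\<Sum>x\<in>S. entropy (\<lambda>r. F (swap k x \<circ> r)) R) + entropy s S"
      unfolding s_def R_def using entropy_permutations_chain_rule[OF S k pos] by simp
    then show ?thesis using cond marg' by (simp add: algebra_simps)
  qed
  \<comment> \<open>a pair \<open>i \<noteq> j\<close> survives the deletion of \<open>k\<close> for \<open>card S - 2 = n - 1\<close> choices of \<open>k\<close>\<close>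
  have count: "(\<Sum>k\<in>S. \<Sum>i\<in>S - {k}. \<Sum>j\<in>S - {k}. E i j) = (real n - 1) * D"
  proof -
    have "(\<Sum>i\<in>S - {k}. \<Sum>j\<in>S - {k}. E i j) =
        D - (\<Sum>j\<in>S. E k j) - (\<Sum>i\<in>S. E i k)" if k: "k \<in> S" for k
    proof -
      have "(\<Sum>i\<in>S - {k}. \<Sum>j\<in>S - {k}. E i j) = (\<Sum>i\<in>S - {k}. (\<Sum>j\<in>S. E i j) - E i k)"
        using S k by (intro sum.cong refl) (simp add: sum_diff1)
      also have "\<dots> = (\<Sum>i\<in>S. (\<Sum>j\<in>S. E i j) - E i k) - ((\<Sum>j\<in>S. E k j) - E k k)"
        using S k by (simp add: sum_diff1)
      finally show ?thesis by (simp add: sum_subtractf D_def E_same)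
    qed
    then have "(\<Sum>k\<in>S. \<Sum>i\<in>S - {k}. \<Sum>j\<in>S - {k}. E i j) =
        real (card S) * D - D - (\<Sum>k\<in>S. \<Sum>i\<in>S. E i k)"
      by (simp add: sum_subtractf D_def)
    also have "(\<Sum>k\<in>S. \<Sum>i\<in>S. E i k) = D" unfolding D_def by (rule sum.swap)
    finally show ?thesis by (simp add: algebra_simps flip: Suc.hyps(2))
  qed
  have "(\<Sum>k\<in>S. 2 * n * entropy F ?P) \<le>
      (\<Sum>k\<in>S. (\<Sum>i\<in>S - {k}. \<Sum>j\<in>S - {k}. E i j) + real n / Suc n * (\<Sum>j\<in>S. E k j))"
    by (intro sum_mono step)
  then have main: "real n * (2 * Suc n * entropy F ?P) \<le> (real n - 1) * D + real n / Suc n * D"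
    unfolding sum.distrib count sum_distrib_left[symmetric] D_def[symmetric]
    by (simp add: algebra_simps flip: Suc.hyps(2))
  \<comment> \<open>the factor \<open>n\<close> in \<open>main\<close> cancels only if it is positive; for \<open>n = 0\<close> the identity is the only permutation, and the entropy vanishes\<close>
  show ?case
  proof (cases "n = 0")
    case True
    then have "card S = 1" using Suc.hyps(2) by simp
    then have "card ?P = 1" using card_permutations[OF _ S, of 1] by simp
    then obtain p where "?P = {p}" by (auto simp: card_1_singleton_iff)
    then have "entropy F ?P = 0" by (simp add: entropy_def)
    then show ?thesis unfolding goal_eq using D by simp
  next
    case False
    have "real n / Suc n * D \<le> D" using D by (simp add: field_simps)
    with main have "real n * (2 * Suc n * entropy F ?P) \<le> real n * D"
      by (simp add: algebra_simps)
    then have "2 * Suc n * entropy F ?P \<le> D" using False by simp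
    then show ?thesis unfolding goal_eq using Suc.hyps(2) by simp
  qed
qed

section \<open>Concentration on the symmetric group\<close>

text \<open>
  The trapezoidal rule overestimates the integral of the convex function \<open>exp\<close> over \<open>[0, x]\<close>.
\<close>

lemma exp_minus_one_le_trapezoid:
  fixes x :: real
  assumes "x \<ge> 0"
  shows "exp x - 1 \<le> x / 2 * (exp x + 1)"
proof -
  define k where "k y = y / 2 * (exp y + 1) - exp y" for y :: real
  have "k 0 \<le> k x"
  proof (rule DERIV_nonneg_imp_nondecreasing[OF assms])
    fix y :: real
    have "(k has_real_derivative (1 - exp y + y * exp y) / 2) (at y)"
      unfolding k_def by (auto intro!: derivative_eq_intros simp: algebra_simps)
    moreover have "1 - exp y + y * exp y = exp y * (exp (- y) - (1 - y))"
      by (simp add: algebra_simps flip: exp_add)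
    moreover have "exp (- y) \<ge> 1 - y"
      using exp_ge_add_one_self[of "- y"] by simp
    ultimately show "\<exists>d. (k has_real_derivative d) (at y) \<and> d \<ge> 0"
      by (metis diff_ge_0_iff_ge divide_nonneg_pos exp_ge_zero mult_nonneg_nonneg zero_less_numeral)
  qed
  then show ?thesis by (simp add: k_def)
qed

lemma log_form_exp_le:
  "log_form (exp a) (exp b) \<le> (a - b)\<^sup>2 * (exp a + exp b) / 2"
proof -
  have *: "log_form (exp a) (exp b) \<le> (a - b)\<^sup>2 * (exp a + exp b) / 2" if "b \<le> a" for a b :: real
  proof -
    define d where "d = a - b"
    have ea: "exp a = exp b * exp d" by (simp add: d_def flip: exp_add)
    have "log_form (exp a) (exp b) = (exp a - exp b) * d"
      by (simp add: log_form_def d_def)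
    also have "\<dots> = d * exp b * (exp d - 1)"
      unfolding ea by (simp add: algebra_simps)
    also have "\<dots> \<le> d * exp b * (d / 2 * (exp d + 1))"
      using that by (intro mult_left_mono exp_minus_one_le_trapezoid) (auto simp: d_def)
    also have "\<dots> = d\<^sup>2 * (exp a + exp b) / 2"
      unfolding ea by (simp add: algebra_simps power2_eq_square)
    finally show ?thesis by (simp add: d_def)
  qed
  show ?thesis
    using *[of b a] *[of a b]
    by (cases "b \<le> a") (auto simp: log_form_commute[of "exp a"] power2_commute[of a] add.commute)
qed

lemma entropy_exp_permutations_le:
  fixes g :: "('a \<Rightarrow> 'a) \<Rightarrow> real"
  assumes S: "finite S"
    and V: "\<And>p. p permutes S \<Longrightarrow> (\<Sum>i\<in>S. \<Sum>j\<in>S. (g p - g (p \<circ> swap i j))\<^sup>2) \<le> V"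
  shows "2 * card S * entropy (\<lambda>p. exp (s * g p)) {p. p permutes S}
    \<le> s\<^sup>2 * V * (\<Sum>p | p permutes S. exp (s * g p))"
proof -
  let ?P = "{p. p permutes S}"
  define d where "d p i j = (g p - g (p \<circ> swap i j))\<^sup>2" for p i j
  have ss: "p \<circ> swap i j \<circ> swap i j = p" for p :: "'a \<Rightarrow> 'a" and i j
    by (simp add: comp_assoc)
  have "2 * card S * entropy (\<lambda>p. exp (s * g p)) ?P \<le>
      (\<Sum>p\<in>?P. \<Sum>i\<in>S. \<Sum>j\<in>S. log_form (exp (s * g p)) (exp (s * g (p \<circ> swap i j))))"
    by (rule modified_log_sobolev_permutations[OF S]) simp
  also have "\<dots> \<le> (\<Sum>p\<in>?P. \<Sum>i\<in>S. \<Sum>j\<in>S.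
      s\<^sup>2 / 2 * (d p i j * exp (s * g p) + d p i j * exp (s * g (p \<circ> swap i j))))"
  proof (intro sum_mono)
    fix p i j
    have "(s * g p - s * g (p \<circ> swap i j))\<^sup>2 = s\<^sup>2 * d p i j"
      unfolding d_def power_mult_distrib[symmetric] by (simp add: right_diff_distrib)
    then show "log_form (exp (s * g p)) (exp (s * g (p \<circ> swap i j))) \<le>
      s\<^sup>2 / 2 * (d p i j * exp (s * g p) + d p i j * exp (s * g (p \<circ> swap i j)))"
      using log_form_exp_le[of "s * g p" "s * g (p \<circ> swap i j)"] by (simp add: algebra_simps)
  qed
  also have "\<dots> = (\<Sum>i\<in>S. \<Sum>j\<in>S. s\<^sup>2 / 2 * ((\<Sum>p\<in>?P. d p i j * exp (s * g p)) +
      (\<Sum>p\<in>?P. d p i j * exp (s * g (p \<circ> swap i j)))))"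
    by (simp only: sum_swap3[where A = ?P] sum_distrib_left sum.distrib distrib_left)
  \<comment> \<open>reversibility: composition with a transposition preserves the uniform distribution and exchanges the two terms\<close>
  also have "\<dots> = (\<Sum>i\<in>S. \<Sum>j\<in>S. s\<^sup>2 * (\<Sum>p\<in>?P. d p i j * exp (s * g p)))"
  proof (intro sum.cong refl)
    fix i j assume "i \<in> S" "j \<in> S"
    then have "swap i j permutes S" by (rule permutes_swap_id)
    from sum_permutations_compose_right[OF this, of "\<lambda>p. d p i j * exp (s * g (p \<circ> swap i j))"]
    have "(\<Sum>p\<in>?P. d p i j * exp (s * g (p \<circ> swap i j))) = (\<Sum>p\<in>?P. d p i j * exp (s * g p))"
      by (simp add: ss d_def power2_commute)
    then show "s\<^sup>2 / 2 * ((\<Sum>p\<in>?P. d p i j * exp (s * g p)) +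
      (\<Sum>p\<in>?P. d p i j * exp (s * g (p \<circ> swap i j)))) = s\<^sup>2 * (\<Sum>p\<in>?P. d p i j * exp (s * g p))"
      by simp
  qed
  also have "\<dots> = s\<^sup>2 * (\<Sum>p\<in>?P. (\<Sum>i\<in>S. \<Sum>j\<in>S. d p i j) * exp (s * g p))"
    unfolding sum_distrib_left sum_distrib_right
    by (simp only: sum_swap3[where A = ?P] mult.assoc)
  also have "\<dots> \<le> s\<^sup>2 * (\<Sum>p\<in>?P. V * exp (s * g p))"
    using V by (intro mult_left_mono sum_mono mult_right_mono) (auto simp: d_def)
  finally show ?thesis by (simp add: sum_distrib_left mult.assoc)
qed

text \<open>
  With \<open>L r = ln E (exp (r g))\<close>, the entropy bound says that the derivative of \<open>L r / r\<close> is at most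
  \<open>c\<close>, and \<open>L r / r\<close> tends to \<open>E g\<close> as \<open>r\<close> decreases to \<open>0\<close>.
\<close>

lemma herbst_argument:
  fixes g :: "'i \<Rightarrow> real"
  assumes A: "finite A" "A \<noteq> {}" and s: "s > 0"
    and ent: "\<And>r. r > 0 \<Longrightarrow> entropy (\<lambda>i. exp (r * g i)) A \<le> c * r\<^sup>2 * (\<Sum>i\<in>A. exp (r * g i))"
  shows "(\<Sum>i\<in>A. exp (s * g i)) / card A \<le> exp (s * (sum g A / card A) + c * s\<^sup>2)"
proof -
  define n where "n = real (card A)"
  have n: "n > 0" using A by (auto simp: n_def card_gt_0_iff)
  define M where "M r = (\<Sum>i\<in>A. exp (r * g i))" for r
  define M' where "M' r = (\<Sum>i\<in>A. g i * exp (r * g i))" for r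
  define L where "L r = ln (M r / n)" for r
  define G where "G r = L r / r - c * r" for r
  have M: "M r > 0" for r unfolding M_def using A by (intro sum_pos) auto
  have dM: "(M has_real_derivative M' r) (at r)" for r
    unfolding M_def M'_def by (auto intro!: derivative_eq_intros sum.cong simp: mult.commute)
  have dL: "(L has_real_derivative M' r / M r) (at r)" for r
    unfolding L_def using M[of r] n
    by (auto intro!: derivative_eq_intros dM simp: field_simps)
  have decr: "G s \<le> G r" if "0 < r" "r \<le> s" for r
  proof (rule DERIV_nonpos_imp_nonincreasing[OF that(2)])
    fix u assume "r \<le> u" "u \<le> s"
    then have u: "u > 0" using that by simp
    have "(G has_real_derivative (M' u / M u * u - L u) / u\<^sup>2 - c) (at u)"
      unfolding G_def using u by (auto intro!: derivative_eq_intros dL simp: power2_eq_square)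
    moreover have "(M' u / M u * u - L u) / u\<^sup>2 - c \<le> 0"
    proof -
      have "entropy (\<lambda>i. exp (u * g i)) A = u * M' u - M u * L u"
        by (simp add: entropy_def M_def M'_def L_def n_def sum_distrib_left algebra_simps)
      then have "u * M' u - M u * L u \<le> c * u\<^sup>2 * M u"
        using ent[OF u] by (simp add: M_def)
      then have "M' u / M u * u - L u \<le> c * u\<^sup>2"
        using M[of u] by (simp add: field_simps)
      then show ?thesis using u by (simp add: field_simps)
    qed
    ultimately show "\<exists>d. (G has_real_derivative d) (at u) \<and> d \<le> 0" by blast
  qed
  have L0: "L 0 = 0" using n by (simp add: L_def M_def n_def)
  have "M' 0 / M 0 = sum g A / card A" by (simp add: M_def M'_def)
  with dL[of 0] have "((\<lambda>r. L r / r) \<longlongrightarrow> sum g A / card A) (at 0)"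
    by (simp add: DERIV_def L0)
  then have "((\<lambda>r. L r / r) \<longlongrightarrow> sum g A / card A) (at_right 0)"
    by (rule filterlim_mono) (auto simp: at_within_le_at)
  then have "(G \<longlongrightarrow> sum g A / card A - c * 0) (at_right 0)"
    unfolding G_def by (rule tendsto_diff) (intro tendsto_intros)
  moreover have "eventually (\<lambda>r. G s \<le> G r) (at_right 0)"
    using eventually_at_right_less[of 0] eventually_at_right_real[OF s]
    by eventually_elim (auto intro: decr)
  ultimately have "G s \<le> sum g A / card A"
    using tendsto_lowerbound[of G "sum g A / card A" "at_right 0"] by simp
  then have "L s \<le> s * (sum g A / card A) + c * s\<^sup>2"
    using s by (simp add: G_def field_simps power2_eq_square)
  then have "exp (L s) \<le> exp (s * (sum g A / card A) + c * s\<^sup>2)" by simp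
  moreover have "exp (L s) = M s / n" using M[of s] n by (simp add: L_def)
  ultimately show ?thesis by (simp add: M_def n_def)
qed

text \<open>
  Chernoff's method with the moment bound of Herbst's argument.
\<close>

theorem permutation_concentration:
  fixes g :: "('a \<Rightarrow> 'a) \<Rightarrow> real" and t V :: real
  assumes S: "finite S" "S \<noteq> {}" and t: "t > 0" and "V > 0"
    and V: "\<And>p. p permutes S \<Longrightarrow> (\<Sum>i\<in>S. \<Sum>j\<in>S. (g p - g (p \<circ> swap i j))\<^sup>2) \<le> V"
  defines "m \<equiv> (\<Sum>p | p permutes S. g p) / card {p. p permutes S}"
  shows "measure_pmf.prob (pmf_of_set {p. p permutes S}) {p. g p \<ge> m + t}
    \<le> exp (- (card S * t\<^sup>2 / (2 * V)))"
proof -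
  let ?P = "{p. p permutes S}"
  define n where "n = real (card S)"
  define c where "c = V / (2 * n)"
  \<comment> \<open>the minimiser of \<open>c * s\<^sup>2 - s * t\<close>\<close>
  define s where "s = t / (2 * c)"
  have n: "n > 0" using S by (auto simp: n_def card_gt_0_iff)
  have c: "c > 0" using n \<open>V > 0\<close> by (simp add: c_def)
  have s: "s > 0" using c t by (simp add: s_def)
  have P: "finite ?P" "?P \<noteq> {}"
    using finite_permutations[OF S(1)] permutes_id[of S] by blast+
  have N: "real (card ?P) > 0" using P by (auto simp: card_gt_0_iff)
  have "entropy (\<lambda>p. exp (r * g p)) ?P \<le> c * r\<^sup>2 * (\<Sum>p\<in>?P. exp (r * g p))" for r
    using entropy_exp_permutations_le[OF S(1) V, of r] n by (simp add: c_def n_def field_simps)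
  then have mgf: "(\<Sum>p\<in>?P. exp (s * g p)) / card ?P \<le> exp (s * m + c * s\<^sup>2)"
    unfolding m_def by (intro herbst_argument P s)
  have "exp (s * (m + t)) * card (?P \<inter> {p. g p \<ge> m + t}) =
      (\<Sum>p\<in>?P \<inter> {p. g p \<ge> m + t}. exp (s * (m + t)))" by simp
  also have "\<dots> \<le> (\<Sum>p\<in>?P \<inter> {p. g p \<ge> m + t}. exp (s * g p))"
    using s by (intro sum_mono) auto
  also have "\<dots> \<le> (\<Sum>p\<in>?P. exp (s * g p))"
    using P by (intro sum_mono2) auto
  also have "\<dots> \<le> card ?P * exp (s * m + c * s\<^sup>2)"
    using mgf N by (simp add: field_simps)
  finally have "card (?P \<inter> {p. g p \<ge> m + t}) / card ?P \<le> exp (s * m + c * s\<^sup>2) / exp (s * (m + t))"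
    using N by (simp add: field_simps)
  also have "\<dots> = exp (c * s\<^sup>2 - s * t)"
    by (simp add: algebra_simps flip: exp_diff)
  also have "c * s\<^sup>2 - s * t = - (n * t\<^sup>2 / (2 * V))"
    using n c \<open>V > 0\<close> by (simp add: s_def c_def field_simps power2_eq_square)
  finally show ?thesis
    by (simp add: measure_pmf_of_set[OF P(2,1)] n_def)
qed

section \<open>Contrasts of permuted vectors\<close>

text \<open>
  Under a uniform permutation, \<open>(p i, p j)\<close> with \<open>i \<noteq> j\<close> is uniform on the ordered pairs of
  distinct elements.
\<close>

lemma sum_permutations_pair:
  fixes q :: "'a \<Rightarrow> 'a \<Rightarrow> real"
  assumes S: "finite S" and ij: "i \<in> S" "j \<in> S" "i \<noteq> j" and diag: "\<And>x. q x x = 0"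
  shows "real (card S) * (real (card S) - 1) * (\<Sum>p | p permutes S. q (p i) (p j))
    = card {p. p permutes S} * (\<Sum>x\<in>S. \<Sum>y\<in>S. q x y)"
proof -
  let ?P = "{p. p permutes S}"
  define T where "T k l = (\<Sum>p\<in>?P. q (p k) (p l))" for k l
  have T: "T k l = (if k = l then 0 else T i j)" if kl: "k \<in> S" "l \<in> S" for k l
  proof (cases "k = l")
    case False
    \<comment> \<open>a permutation taking \<open>i\<close> to \<open>k\<close> and \<open>j\<close> to \<open>l\<close>\<close>
    let ?r = "swap (swap i k j) l \<circ> swap i k"
    have "swap i k j \<in> S" using ij kl by (auto simp: Transposition.transpose_def)
    then have r: "?r permutes S"
      using ij kl by (intro permutes_compose permutes_swap_id)
    have "?r i = k" "?r j = l"
      using ij False by (auto simp: Transposition.transpose_def)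
    moreover have "T (?r i) (?r j) = T i j"
      unfolding T_def using sum_permutations_compose_right[OF r, of "\<lambda>p. q (p i) (p j)"] by simp
    ultimately show ?thesis using False by simp
  qed (simp add: T_def diag)
  have "(\<Sum>k\<in>S. \<Sum>l\<in>S. T k l) = (\<Sum>k\<in>S. \<Sum>l\<in>S. T i j - (if k = l then T i j else 0))"
    by (intro sum.cong refl) (simp add: T)
  also have "\<dots> = real (card S) * (real (card S) - 1) * T i j"
    using S by (simp add: sum_subtractf algebra_simps)
  finally have "real (card S) * (real (card S) - 1) * T i j = (\<Sum>k\<in>S. \<Sum>l\<in>S. T k l)" ..
  also have "\<dots> = (\<Sum>p\<in>?P. \<Sum>k\<in>S. \<Sum>l\<in>S. q (p k) (p l))"
    unfolding T_def by (simp only: sum_swap3[where A = ?P])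
  also have "\<dots> = (\<Sum>p\<in>?P. \<Sum>x\<in>S. \<Sum>y\<in>S. q x y)"
  proof (rule sum.cong[OF refl])
    fix p assume "p \<in> ?P"
    then have p: "p permutes S" by simp
    have "(\<Sum>x\<in>S. \<Sum>y\<in>S. q x y) = (\<Sum>k\<in>S. \<Sum>y\<in>S. q (p k) y)"
      using sum.permute[OF p, of "\<lambda>x. \<Sum>y\<in>S. q x y"] by (simp add: comp_def)
    also have "\<dots> = (\<Sum>k\<in>S. \<Sum>l\<in>S. q (p k) (p l))"
      using sum.permute[OF p, of "q (p _)"] by (simp add: comp_def)
    finally show "(\<Sum>k\<in>S. \<Sum>l\<in>S. q (p k) (p l)) = (\<Sum>x\<in>S. \<Sum>y\<in>S. q x y)" ..
  qed
  finally show ?thesis by (simp add: T_def)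
qed

text \<open>
  For weights of total zero, the squared norm depends on the vectors only through their mutual
  distances.
\<close>

lemma norm_contrast_sq:
  fixes v :: "'i \<Rightarrow> 'h::real_inner" and w :: "'i \<Rightarrow> real"
  assumes "sum w S = 0"
  shows "(norm (\<Sum>i\<in>S. w i *\<^sub>R v i))\<^sup>2 =
    - (\<Sum>i\<in>S. \<Sum>j\<in>S. w i * w j * (norm (v i - v j))\<^sup>2) / 2"
proof -
  have "w i * w j * (norm (v i - v j))\<^sup>2 = w j * (w i * (v i \<bullet> v i)) + w i * (w j * (v j \<bullet> v j))
      - 2 * (w i * w j * (v i \<bullet> v j))" for i j
    by (simp add: power2_norm_eq_inner inner_diff_left inner_diff_right inner_commute algebra_simps)
  then have "(\<Sum>i\<in>S. \<Sum>j\<in>S. w i * w j * (norm (v i - v j))\<^sup>2) =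
      sum w S * (\<Sum>i\<in>S. w i * (v i \<bullet> v i)) + sum w S * (\<Sum>j\<in>S. w j * (v j \<bullet> v j))
      - 2 * (\<Sum>i\<in>S. \<Sum>j\<in>S. w i * w j * (v i \<bullet> v j))"
    by (simp add: sum_subtractf sum.distrib flip: sum_distrib_left sum_distrib_right)
  moreover have "(norm (\<Sum>i\<in>S. w i *\<^sub>R v i))\<^sup>2 = (\<Sum>i\<in>S. \<Sum>j\<in>S. w i * w j * (v i \<bullet> v j))"
    by (simp add: power2_norm_eq_inner inner_sum_left inner_sum_right sum_distrib_left mult_ac inner_commute)
  ultimately show ?thesis using assms by simp
qed

lemma contrast_second_moment:
  fixes u :: "'a \<Rightarrow> 'h::real_inner" and w :: "'a \<Rightarrow> real"
  assumes S: "finite S" and w: "sum w S = 0"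
  shows "real (card S) * (real (card S) - 1) *
      (\<Sum>p | p permutes S. (norm (\<Sum>i\<in>S. w i *\<^sub>R u (p i)))\<^sup>2)
    = card {p. p permutes S} * (\<Sum>i\<in>S. (w i)\<^sup>2) * (\<Sum>x\<in>S. \<Sum>y\<in>S. (norm (u x - u y))\<^sup>2) / 2"
proof -
  let ?P = "{p. p permutes S}"
  define n where "n = real (card S) * (real (card S) - 1)"
  define Q where "Q = card ?P * (\<Sum>x\<in>S. \<Sum>y\<in>S. (norm (u x - u y))\<^sup>2)"
  define T where "T i j = (\<Sum>p\<in>?P. (norm (u (p i) - u (p j)))\<^sup>2)" for i j
  have T: "n * T i j = (if i = j then 0 else Q)" if "i \<in> S" "j \<in> S" for i j
  proof (cases "i = j")
    case False
    then show ?thesis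
      using sum_permutations_pair[OF S that, of "\<lambda>x y. (norm (u x - u y))\<^sup>2"]
      by (simp add: n_def T_def Q_def)
  qed (simp add: T_def)
  have "n * (\<Sum>p\<in>?P. (norm (\<Sum>i\<in>S. w i *\<^sub>R u (p i)))\<^sup>2)
      = - (n * (\<Sum>p\<in>?P. \<Sum>i\<in>S. \<Sum>j\<in>S. w i * w j * (norm (u (p i) - u (p j)))\<^sup>2)) / 2"
    by (simp add: norm_contrast_sq[OF w] sum_negf flip: sum_divide_distrib)
  also have "\<dots> = - (\<Sum>i\<in>S. \<Sum>j\<in>S. w i * w j * (n * T i j)) / 2"
    unfolding sum_swap3[where A = ?P] T_def by (simp add: sum_distrib_left mult_ac)
  also have "(\<Sum>i\<in>S. \<Sum>j\<in>S. w i * w j * (n * T i j)) =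
      (\<Sum>i\<in>S. \<Sum>j\<in>S. w i * w j * Q - (if i = j then w i * w i * Q else 0))"
    by (intro sum.cong refl) (simp add: T)
  also have "\<dots> = sum w S * sum w S * Q - (\<Sum>i\<in>S. (w i)\<^sup>2) * Q"
    using S by (simp add: sum_subtractf power2_eq_square flip: sum_distrib_left sum_distrib_right)
  finally show ?thesis by (simp add: w n_def Q_def)
qed

lemma norm_contrast_swap:
  fixes u :: "'a \<Rightarrow> 'h::real_inner" and w :: "'a \<Rightarrow> real"
  assumes S: "finite S" and ij: "i \<in> S" "j \<in> S"
  shows "\<bar>norm (\<Sum>l\<in>S. w l *\<^sub>R u (p l)) - norm (\<Sum>l\<in>S. w l *\<^sub>R u ((p \<circ> swap i j) l))\<bar>
    \<le> \<bar>w i - w j\<bar> * norm (u (p i) - u (p j))"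
proof (cases "i = j")
  case False
  let ?d = "\<lambda>l. w l *\<^sub>R u (p l) - w l *\<^sub>R u ((p \<circ> swap i j) l)"
  have "(\<Sum>l\<in>S. w l *\<^sub>R u (p l)) - (\<Sum>l\<in>S. w l *\<^sub>R u ((p \<circ> swap i j) l)) = sum ?d S"
    by (simp add: sum_subtractf)
  also have "\<dots> = sum ?d {i, j}"
    using S ij by (intro sum.mono_neutral_right) auto
  also have "\<dots> = (w i - w j) *\<^sub>R (u (p i) - u (p j))"
    using False by (simp add: algebra_simps)
  finally show ?thesis
    using norm_triangle_ineq3[of "\<Sum>l\<in>S. w l *\<^sub>R u (p l)" "\<Sum>l\<in>S. w l *\<^sub>R u ((p \<circ> swap i j) l)"]
    by simp
qed simp

text \<open>
  The squared increments of the norm of a contrast over all transpositions of positions, bounded by a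
  quantity that no longer depends on the permutation.
\<close>

lemma contrast_swap_sum:
  fixes u :: "'a \<Rightarrow> 'h::real_inner" and w :: "'a \<Rightarrow> real"
  assumes S: "finite S" and w: "\<And>i j. i \<in> S \<Longrightarrow> j \<in> S \<Longrightarrow> \<bar>w i - w j\<bar> \<le> \<delta>"
    and p: "p permutes S"
  shows "(\<Sum>i\<in>S. \<Sum>j\<in>S. (norm (\<Sum>l\<in>S. w l *\<^sub>R u (p l)) -
      norm (\<Sum>l\<in>S. w l *\<^sub>R u ((p \<circ> swap i j) l)))\<^sup>2)
    \<le> \<delta>\<^sup>2 * (\<Sum>x\<in>S. \<Sum>y\<in>S. (norm (u x - u y))\<^sup>2)"
proof -
  have "(\<Sum>i\<in>S. \<Sum>j\<in>S. (norm (\<Sum>l\<in>S. w l *\<^sub>R u (p l)) -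
      norm (\<Sum>l\<in>S. w l *\<^sub>R u ((p \<circ> swap i j) l)))\<^sup>2)
    \<le> (\<Sum>i\<in>S. \<Sum>j\<in>S. \<delta>\<^sup>2 * (norm (u (p i) - u (p j)))\<^sup>2)"
  proof (intro sum_mono)
    fix i j assume ij: "i \<in> S" "j \<in> S"
    have "\<bar>norm (\<Sum>l\<in>S. w l *\<^sub>R u (p l)) - norm (\<Sum>l\<in>S. w l *\<^sub>R u ((p \<circ> swap i j) l))\<bar>
      \<le> \<delta> * norm (u (p i) - u (p j))"
      by (rule order_trans[OF norm_contrast_swap[OF S ij] mult_right_mono[OF w[OF ij]]]) simp
    then have "\<bar>norm (\<Sum>l\<in>S. w l *\<^sub>R u (p l)) - norm (\<Sum>l\<in>S. w l *\<^sub>R u ((p \<circ> swap i j) l))\<bar>\<^sup>2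
      \<le> (\<delta> * norm (u (p i) - u (p j)))\<^sup>2"
      by (intro power_mono) auto
    then show "(norm (\<Sum>l\<in>S. w l *\<^sub>R u (p l)) - norm (\<Sum>l\<in>S. w l *\<^sub>R u ((p \<circ> swap i j) l)))\<^sup>2
      \<le> \<delta>\<^sup>2 * (norm (u (p i) - u (p j)))\<^sup>2"
      by (simp only: power2_abs power_mult_distrib)
  qed
  also have "\<dots> = \<delta>\<^sup>2 * (\<Sum>i\<in>S. \<Sum>j\<in>S. (norm (u (p i) - u (p j)))\<^sup>2)"
    by (simp add: sum_distrib_left)
  also have "(\<Sum>i\<in>S. \<Sum>j\<in>S. (norm (u (p i) - u (p j)))\<^sup>2) = (\<Sum>x\<in>S. \<Sum>y\<in>S. (norm (u x - u y))\<^sup>2)"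
    using sum.permute[OF p, of "\<lambda>x. \<Sum>y\<in>S. (norm (u x - u y))\<^sup>2"]
      sum.permute[OF p, of "\<lambda>y. (norm (u (p _) - u y))\<^sup>2"] by (simp add: comp_def)
  finally show ?thesis .
qed

section \<open>The permuted two-sample statistic\<close>

text \<open>
  The weights of the two-sample contrast: \<open>1/n1\<close> on the positions \<open>1..n1\<close> and \<open>-1/n2\<close> on the
  later ones.
\<close>

definition group_weight :: "nat \<Rightarrow> nat \<Rightarrow> nat \<Rightarrow> real" where
  "group_weight n1 n2 i = (if i \<le> n1 then 1 / real n1 else - (1 / real n2))"

lemma sum_split_groups:
  fixes f :: "nat \<Rightarrow> 'b::comm_monoid_add"
  shows "(\<Sum>i=1..n1 + n2. f i) = (\<Sum>i=1..n1. f i) + (\<Sum>j=1..n2. f (n1 + j))"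
proof -
  have "{1..n1 + n2} = {1..n1} \<union> {n1 + 1..n1 + n2}" by auto
  moreover have "(\<Sum>i=n1 + 1..n1 + n2. f i) = (\<Sum>j=1..n2. f (n1 + j))"
    using sum.shift_bounds_cl_nat_ivl[of f 1 n1 n2] by (simp add: add.commute)
  ultimately show ?thesis by (simp add: sum.union_disjoint)
qed

lemma perm_stat_eq_contrast:
  "perm_stat \<psi> n1 n2 Z b = norm (\<Sum>i=1..n1 + n2. group_weight n1 n2 i *\<^sub>R \<psi> (Z (b i)))"
  unfolding perm_stat_def sum_split_groups
  by (simp add: group_weight_def scaleR_sum_right sum_negf)

lemma group_weight_sums:
  assumes "n1 \<ge> 1" "n2 \<ge> 1"
  shows "(\<Sum>i=1..n1 + n2. group_weight n1 n2 i) = 0"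
    and "(\<Sum>i=1..n1 + n2. (group_weight n1 n2 i)\<^sup>2) = 1 / n1 + 1 / n2"
  unfolding sum_split_groups using assms by (simp_all add: group_weight_def power2_eq_square)

lemma htilde_feature_map:
  assumes "feature_map \<psi> h"
  shows "htilde h x y = (norm (\<psi> x - \<psi> y))\<^sup>2"
  using assms
  by (simp add: feature_map_def htilde_def power2_norm_eq_inner inner_diff_left inner_diff_right inner_commute)

theorem theorem5p1:
  fixes val :: "'h::{real_inner,complete_space} \<Rightarrow> 'x \<Rightarrow> real"
    and h :: "'x \<Rightarrow> 'x \<Rightarrow> real"
    and \<psi> :: "'x \<Rightarrow> 'h"
    and n1 n2 N :: nat
    and X1 X2 Z :: "nat \<Rightarrow> 'x"
    and \<sigma>2 \<gamma> :: real
  assumes "rkhs_kernel val h"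
    and "feature_map \<psi> h"
    and "n1 \<ge> 1" and "n2 \<ge> 1"
    and "N = n1 + n2"
    and "Z = pooled n1 X1 X2"
    and "\<gamma> = gamma12 n1 n2"
    and "\<sigma>2 = sigma2 h N Z"
  shows "(\<forall>i\<in>{1..N}. \<forall>j\<in>{1..N}. htilde h (Z i) (Z j) \<ge> 0) \<and>
    (\<forall>t::real. t > 0 \<longrightarrow>
      measure_pmf.prob (perm_pmf N)
        {b. perm_stat \<psi> n1 n2 Z b \<ge> t + sqrt (\<sigma>2 / (2 * real N * \<gamma>))}
      \<le> (if \<sigma>2 = 0 then 0 else exp (- (real N * \<gamma>^2 * t^2 / (2 * \<sigma>2)))))"
proof (intro conjI ballI allI impI)
  note htilde = htilde_feature_map[OF assms(2)]
  show "htilde h (Z i) (Z j) \<ge> 0" for i j by (simp add: htilde)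
  fix t :: real assume t: "t > 0"
  let ?S = "{1..N}" and ?P = "{p. p permutes {1..N}}"
  define w where "w = group_weight n1 n2"
  define u where "u i = \<psi> (Z i)" for i
  define Q where "Q = (\<Sum>x\<in>?S. \<Sum>y\<in>?S. (norm (u x - u y))\<^sup>2)"
  define g where "g p = norm (\<Sum>i\<in>?S. w i *\<^sub>R u (p i))" for p
  define \<delta> where "\<delta> = 1 / real n1 + 1 / real n2"
  define m where "m = (\<Sum>p\<in>?P. g p) / card ?P"
  have N: "real N \<ge> 2" using assms(3-5) by simp
  have stat: "perm_stat \<psi> n1 n2 Z = g"
    by (rule ext) (simp add: perm_stat_eq_contrast g_def w_def u_def assms(5))
  have fin: "finite ?P" by (rule finite_permutations) simp
  have ne: "?P \<noteq> {}" using permutes_id[of ?S] by blast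
  have P: "real (card ?P) > 0" using fin ne by (auto simp: card_gt_0_iff)
  have \<delta>: "\<delta> > 0" using assms(3,4) by (simp add: \<delta>_def add_pos_pos)
  have \<gamma>: "\<gamma> = 1 / (N * \<delta>)"
    using assms(3-5,7) by (simp add: gamma12_def \<delta>_def field_simps power2_eq_square)
  have \<sigma>2: "\<sigma>2 = Q / (N * (real N - 1))"
  proof -
    have "(\<Sum>j\<in>?S - {i}. htilde h (Z i) (Z j)) = (\<Sum>j\<in>?S. (norm (u i - u j))\<^sup>2)" if "i \<in> ?S" for i
      using that by (simp add: htilde u_def sum_diff1)
    then show ?thesis
      unfolding assms(8) sigma2_def Q_def by simp
  qed
  have Q: "Q \<ge> 0" unfolding Q_def by (intro sum_nonneg) simp
  have moment: "(\<Sum>p\<in>?P. (g p)\<^sup>2) / card ?P = \<sigma>2 / (2 * real N * \<gamma>)"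
  proof -
    have "real N * (real N - 1) * (\<Sum>p\<in>?P. (g p)\<^sup>2) = card ?P * \<delta> * Q / 2"
      using contrast_second_moment[of ?S w u] group_weight_sums[OF assms(3,4)]
      by (simp add: g_def w_def Q_def \<delta>_def assms(5))
    then have "(\<Sum>p\<in>?P. (g p)\<^sup>2) / card ?P = \<delta> * Q / (2 * (real N * (real N - 1)))"
      using N P by (simp add: field_simps)
    also have "\<dots> = \<sigma>2 / (2 * real N * \<gamma>)"
      using N \<delta> by (simp add: \<sigma>2 \<gamma> mult_ac)
    finally show ?thesis .
  qed
  show "measure_pmf.prob (perm_pmf N) {b. perm_stat \<psi> n1 n2 Z b \<ge> t + sqrt (\<sigma>2 / (2 * real N * \<gamma>))}
      \<le> (if \<sigma>2 = 0 then 0 else exp (- (real N * \<gamma>^2 * t^2 / (2 * \<sigma>2))))"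
  proof (cases "\<sigma>2 = 0")
    case True
    then have "(\<Sum>p\<in>?P. (g p)\<^sup>2) = 0" using moment P by simp
    then have "\<forall>p\<in>?P. g p = 0" using fin by (simp add: sum_nonneg_eq_0_iff)
    then have "?P \<inter> {b. g b \<ge> t} = {}" using t by auto
    then have "measure_pmf.prob (pmf_of_set ?P) {b. g b \<ge> t} = 0"
      unfolding measure_pmf_of_set[OF ne fin] by simp
    then show ?thesis
      using True by (simp add: stat perm_pmf_def)
  next
    case False
    then have "Q \<noteq> 0" unfolding \<sigma>2 by fastforce
    then have "Q > 0" using Q by linarith
    have "m\<^sup>2 \<le> (\<Sum>p\<in>?P. (g p)\<^sup>2) / card ?P"
    proof -
      have "(\<Sum>p\<in>?P. g p)\<^sup>2 \<le> (\<Sum>p\<in>?P. (g p)\<^sup>2) * card ?P"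
        by (rule sum_squared_le_sum_of_squares)
      then show ?thesis using P by (simp add: m_def field_simps power2_eq_square)
    qed
    then have m: "m \<le> sqrt (\<sigma>2 / (2 * real N * \<gamma>))"
      unfolding moment by (rule real_le_rsqrt)
    have "1 / real n1 \<ge> 0" "1 / real n2 \<ge> 0" by auto
    then have "\<bar>w i - w j\<bar> \<le> \<delta>" for i j
      unfolding w_def group_weight_def \<delta>_def by (simp only: split: if_split) linarith
    then have V: "(\<Sum>i\<in>?S. \<Sum>j\<in>?S. (g p - g (p \<circ> swap i j))\<^sup>2) \<le> \<delta>\<^sup>2 * Q" if "p permutes ?S" for p
      unfolding g_def Q_def using that by (intro contrast_swap_sum) auto
    have "measure_pmf.prob (perm_pmf N) {b. g b \<ge> t + sqrt (\<sigma>2 / (2 * real N * \<gamma>))}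
        \<le> measure_pmf.prob (perm_pmf N) {b. g b \<ge> m + t}"
      using m by (intro measure_pmf.finite_measure_mono) auto
    also have "\<dots> \<le> exp (- (card ?S * t\<^sup>2 / (2 * (\<delta>\<^sup>2 * Q))))"
      unfolding perm_pmf_def m_def using t N \<delta> \<open>Q > 0\<close>
      by (intro permutation_concentration V) auto
    also have "\<dots> \<le> exp (- (real N * \<gamma>^2 * t^2 / (2 * \<sigma>2)))"
    proof -
      have "real N * \<gamma>^2 * t^2 / (2 * \<sigma>2) = (real N - 1) * (t\<^sup>2 / (2 * (\<delta>\<^sup>2 * Q)))"
        using N \<delta> \<open>Q > 0\<close> by (simp add: \<gamma> \<sigma>2 power2_eq_square mult_ac)
      also have "\<dots> \<le> real N * (t\<^sup>2 / (2 * (\<delta>\<^sup>2 * Q)))"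
        using \<open>Q > 0\<close> by (intro mult_right_mono) auto
      finally show ?thesis by simp
    qed
    finally show ?thesis using False by (simp add: stat)
  qed
qed

end
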